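(* Let $G_{hex}$ be the infinite hexagonal grid, and let $\rho(G_{hex})$ be its surviving rate for one firefighter. Then $\rho(G_{hex})\ge 2/3$. Moreover, suppose that the fire breaks out at a vertex of $G_{hex}$ and that the firefighter, in addition to protecting one vertex in every turn, is allowed to protect one extra vertex at time (turn) $t_1$ and one extra vertex at time (turn) $t_2$, where $1\le t_1\le t_2$ (possibly $t_1=t_2$). Then the firefighter has a strategy that contains the fire on $G_{hex}$. Moreover, the strategy does not need to know $t_1$ and $t_2$ in advance: there is a single strategy whose moves in each turn depend on $t_1$ and $t_2$ only through which extra protections have become available up to and including that turn, and which contains the fire for all $1\le t_1\le t_2$.
   Context: $G_{hex}$ is the infinite 3-regular graph formed by the vertices and edges of the tiling of the plane by regular hexagons; it is vertex-transitive. Firefighter problem: a fire breaks out at a vertex $v$ (at time $0$). In each subsequent turn $1,2,3,\dots$, the firefighter first protects one vertex which is not yet on fire (plus any extra vertices it is allowed to protect in that turn, also not yet on fire), and then the fire spreads to all unprotected neighbors of the vertices already on fire. Once a vertex is on fire or is protected it stays in that state forever. The fire is contained if from some turn on it cannot spread, i.e. no burning vertex has an unprotected non-burning neighbor (so only finitely many vertices ever burn). Surviving rate for infinite graphs: let $G$ be an infinite graph with all degrees finite, and let $N_{\le i}(v)$ be the set of vertices at graph distance at most $i$ from $v$. For a fixed deterministic strategy $\mathcal F$ of the firefighter (protecting one vertex per turn, with no extra protections) for the fire starting at $v$, let $S=S(\mathcal F)$ be the set of saved vertices, i.e. vertices that never catch fire. Put $$\rho_{\mathcal F}(G,v)=\liminf_{i\to\infty}\frac{|N_{\le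 i}(v)\cap S|}{|N_{\le i}(v)|},\qquad \rho(G,v)=\sup_{\mathcal F}\rho_{\mathcal F}(G,v).$$ If $G$ is vertex-transitive, $\rho(G,v)$ does not depend on $v$ and is denoted $\rho(G)$. *)

theory Defs
  imports Complex_Main "HOL-Library.Extended_Nat" "HOL-Library.Extended_Real" "HOL-Library.Liminf_Limsup"
begin

text \<open>A graph is given by its (symmetric, irreflexive) adjacency relation on the type of vertices.\<close>

type_synonym 'a graph = "'a \<Rightarrow> 'a \<Rightarrow> bool"

subsection \<open>The hexagonal grid\<close>

text \<open>
  Regular hexagons of side length 1 tile the plane when their centres form the triangular lattice
  spanned by the vectors \<open>(3 / 2, sqrt 3 / 2)\<close> and \<open>(3 / 2, - sqrt 3 / 2)\<close>. The corners split into two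
  translates of this lattice: the Boolean component of a vertex selects the translate, and the
  integers are the lattice coordinates. The lemmas below the definition of the embedding
  \<open>hex_pos\<close> confirm that the vertices are exactly the corners of these hexagons and that
  adjacency is exactly unit distance.
\<close>

type_synonym hex_vertex = "int \<times> int \<times> bool"

fun hex_adj :: "hex_vertex graph" where
  "hex_adj (i, j, False) (k, l, True) \<longleftrightarrow> (k, l) \<in> {(i, j), (i - 1, j), (i, j - 1)}"
| "hex_adj (k, l, True) (i, j, False) \<longleftrightarrow> (k, l) \<in> {(i, j), (i - 1, j), (i, j - 1)}"
| "hex_adj (i, j, False) (k, l, False) \<longleftrightarrow> False"
| "hex_adj (i, j, True) (k, l, True) \<longleftrightarrow> False"

definition hex_centre :: "int \<Rightarrow> int \<Rightarrow> complex" where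
  "hex_centre i j = of_int i * Complex (3 / 2) (sqrt 3 / 2) + of_int j * Complex (3 / 2) (- sqrt 3 / 2)"

fun hex_pos :: "hex_vertex \<Rightarrow> complex" where
  "hex_pos (i, j, b) = hex_centre i j + (if b then 2 else 1)"

lemma Re_hex_centre: "Re (hex_centre i j) = 3 / 2 * (of_int i + of_int j)"
  and Im_hex_centre: "Im (hex_centre i j) = sqrt 3 / 2 * (of_int i - of_int j)"
  by (simp_all add: hex_centre_def algebra_simps)

lemma norm_hex_centre_add:
  fixes i j c :: int
  shows "(cmod (hex_centre i j + of_int c))\<^sup>2
    = of_int (3 * (i\<^sup>2 + i * j + j\<^sup>2) + 3 * c * (i + j) + c\<^sup>2)"
proof -
  have "(sqrt 3 / 2 * (of_int i - of_int j))\<^sup>2 = 3 / 4 * (real_of_int i - of_int j)\<^sup>2"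
    by (simp add: power_mult_distrib power_divide)
  then show ?thesis
    unfolding cmod_power2 by (simp add: Re_hex_centre Im_hex_centre power2_eq_square field_simps)
qed

lemma three_squares_eq_1:
  fixes i j :: int
  shows "3 * (i\<^sup>2 + i * j + j\<^sup>2) + 3 * (i + j) + 1 = 1
    \<longleftrightarrow> (i, j) \<in> {(0, 0), (- 1, 0), (0, - 1)}" (is "?L \<longleftrightarrow> ?R")
proof
  assume ?L
  then have e: "(i + j + 1)\<^sup>2 + i\<^sup>2 + j\<^sup>2 = 1" by (simp add: power2_eq_square algebra_simps)
  then have "i\<^sup>2 \<le> 1" "j\<^sup>2 \<le> 1"
    using zero_le_power2[of "i + j + 1"] zero_le_power2[of i] zero_le_power2[of j] by linarith+
  then have "\<bar>i\<bar> \<le> 1" "\<bar>j\<bar> \<le> 1" by (simp_all add: abs_square_le_1)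
  then have "i \<in> {-1, 0, 1}" "j \<in> {-1, 0, 1}" by auto
  then show ?R using e by auto
qed auto

lemma hex_centre_diff: "hex_centre i j - hex_centre k l = hex_centre (i - k) (j - l)"
  by (simp add: hex_centre_def algebra_simps)

lemma inj_hex_pos: "inj hex_pos"
proof (rule injI)
  fix p q assume eq: "hex_pos p = hex_pos q"
  obtain i j b k l c where pq: "p = (i, j, b)" "q = (k, l, c)" by (metis prod_cases3)
  define d :: int where "d = of_bool b - of_bool c"
  have "hex_centre (i - k) (j - l) + of_int d = 0"
    using eq unfolding hex_centre_diff[symmetric]
    by (cases b; cases c) (simp_all add: pq d_def algebra_simps)
  then have z: "3 * ((i - k)\<^sup>2 + (i - k) * (j - l) + (j - l)\<^sup>2) + 3 * d * ((i - k) + (j - l)) + d\<^sup>2 = 0"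
    using norm_hex_centre_add[of "i - k" "j - l" d] by (metis norm_zero of_int_eq_0_iff zero_power2)
  have "d \<in> {-1, 0, 1}" by (auto simp: d_def)
  moreover have "3 dvd d\<^sup>2"
  proof -
    have "d\<^sup>2 = 3 * (- ((i - k)\<^sup>2 + (i - k) * (j - l) + (j - l)\<^sup>2) - d * ((i - k) + (j - l)))"
      using z by (simp add: algebra_simps)
    then show ?thesis by (metis dvd_triv_left)
  qed
  ultimately have "d = 0" by auto
  then have "b = c" by (auto simp: d_def split: if_splits)
  moreover have "(i - k + (j - l))\<^sup>2 + (i - k)\<^sup>2 + (j - l)\<^sup>2 = 0"
    using z \<open>d = 0\<close> by (simp add: power2_eq_square algebra_simps)
  then have "(i - k)\<^sup>2 = 0" "(j - l)\<^sup>2 = 0"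
    using zero_le_power2[of "i - k + (j - l)"] zero_le_power2[of "i - k"] zero_le_power2[of "j - l"]
    by linarith+
  then have "i = k \<and> j = l" by simp
  ultimately show "p = q" by (simp add: pq)
qed

lemma hex_adj_commute: "hex_adj p q = hex_adj q p"
  by (cases "(p, q)" rule: hex_adj.cases) auto

lemma hex_adj_iff_dist_1: "hex_adj p q \<longleftrightarrow> dist (hex_pos p) (hex_pos q) = 1"
proof -
  have sq: "dist x y = 1 \<longleftrightarrow> (dist x y)\<^sup>2 = 1" for x y :: complex
    by (simp add: power2_eq_1_iff) (smt (verit) zero_le_dist)
  have A: "hex_adj (k, l, True) (i, j, False)
      \<longleftrightarrow> dist (hex_pos (k, l, True)) (hex_pos (i, j, False)) = 1" for i j k l
  proof -
    have "dist (hex_pos (k, l, True)) (hex_pos (i, j, False)) = cmod (hex_centre (k - i) (l - j) + of_int 1)"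
      by (simp add: dist_norm flip: hex_centre_diff)
        (simp add: algebra_simps)
    then have "dist (hex_pos (k, l, True)) (hex_pos (i, j, False)) = 1 \<longleftrightarrow>
        real_of_int (3 * ((k-i)\<^sup>2 + (k-i) * (l-j) + (l-j)\<^sup>2) + 3 * ((k-i) + (l-j)) + 1) = of_int 1"
      unfolding sq using norm_hex_centre_add[of "k - i" "l - j" 1] by simp
    then show ?thesis
      unfolding of_int_eq_iff three_squares_eq_1 by auto
  qed
  have B: "dist (hex_pos (k, l, b)) (hex_pos (i, j, b)) \<noteq> 1" for i j k l b
  proof
    assume "dist (hex_pos (k, l, b)) (hex_pos (i, j, b)) = 1"
    then have "cmod (hex_centre (k - i) (l - j) + of_int 0) = 1"
      by (simp add: dist_norm flip: hex_centre_diff)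
    then have "real_of_int (3 * ((k-i)\<^sup>2 + (k-i) * (l-j) + (l-j)\<^sup>2)) = of_int 1"
      using norm_hex_centre_add[of "k - i" "l - j" 0] by simp
    then have "3 * ((k-i)\<^sup>2 + (k-i) * (l-j) + (l-j)\<^sup>2) = 1" by (simp only: of_int_eq_iff)
    then show False by presburger
  qed
  show ?thesis
  proof (cases "(p, q)" rule: hex_adj.cases)
    case (1 i j k l)
    then show ?thesis
      using A[of k l i j] hex_adj_commute[of p q] dist_commute[of "hex_pos p" "hex_pos q"] by simp
  next
    case (2 k l i j)
    then show ?thesis using A[of k l i j] by simp
  next
    case (3 i j k l)
    then show ?thesis using B[of i j False k l] by simp
  next
    case (4 i j k l)
    then show ?thesis using B[of i j True k l] by simp
  qed
qed

lemma cis_pi_third_multiples: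
  "cis (of_nat n * pi / 3) =
    (if n = 0 then hex_pos (0, 0, False) else if n = 1 then hex_pos (0, - 1, True)
     else if n = 2 then hex_pos (0, - 1, False) else if n = 3 then hex_pos (- 1, - 1, True)
     else if n = 4 then hex_pos (- 1, 0, False) else hex_pos (- 1, 0, True))"
  if "n < 6"
proof -
  have "n \<in> {0, 1, 2, 3, 4, 5}" using that by auto
  moreover have c2: "cos (2 * pi / 3) = - 1 / 2" "sin (2 * pi / 3) = sqrt 3 / 2"
    using cos_120 sin_120 by (simp_all add: mult.commute)
  moreover have "4 * pi / 3 = pi + pi / 3" by simp
  then have c4: "cos (4 * pi / 3) = - 1 / 2" "sin (4 * pi / 3) = - sqrt 3 / 2"
    by (simp_all only: cos_periodic_pi2 sin_periodic_pi2 cos_60 sin_60)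
  moreover have "5 * pi / 3 = 2 * pi - pi / 3" by simp
  then have c5: "cos (5 * pi / 3) = 1 / 2" "sin (5 * pi / 3) = - sqrt 3 / 2"
    by (simp_all only: cos_2pi_minus sin_2pi_minus cos_60 sin_60)
  ultimately show ?thesis
    by (elim insertE emptyE)
      (simp_all add: complex_eq_iff Re_hex_centre Im_hex_centre cos_60 sin_60)
qed

lemma range_hex_pos: "range hex_pos = {hex_centre i j + cis (of_nat n * pi / 3) | i j n. n < 6}"
proof (intro subset_antisym subsetI)
  fix z assume "z \<in> range hex_pos"
  then obtain i j b where z: "z = hex_pos (i, j, b)" by (metis imageE prod_cases3)
  show "z \<in> {hex_centre i j + cis (of_nat n * pi / 3) | i j n. n < 6}"
  proof (cases b)
    case True
    then have "z = hex_centre (i + 1) (j + 1) + cis (of_nat 3 * pi / 3)"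
      by (simp add: z hex_centre_def complex_eq_iff algebra_simps)
    moreover have "(3 :: nat) < 6" by simp
    ultimately show ?thesis by blast
  next
    case False
    then have "z = hex_centre i j + cis (of_nat 0 * pi / 3)" by (simp add: z)
    moreover have "(0 :: nat) < 6" by simp
    ultimately show ?thesis by blast
  qed
next
  fix z assume "z \<in> {hex_centre i j + cis (of_nat n * pi / 3) | i j n. n < 6}"
  then obtain i j n where z: "z = hex_centre i j + cis (of_nat n * pi / 3)" "n < 6" by blast
  have shift: "hex_centre i j + hex_pos (k, l, b) = hex_pos (i + k, j + l, b)" for k l b
    by (simp add: hex_centre_def algebra_simps)
  show "z \<in> range hex_pos"
    unfolding z(1) cis_pi_third_multiples[OF z(2)]
    by (auto simp only: shift rangeI split: if_splits)
qed

subsection \<open>Graph distance\<close>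

text \<open>The distance is the least length of a walk, and \<open>\<infinity>\<close> if there is none.\<close>

definition gdist :: "'a graph \<Rightarrow> 'a \<Rightarrow> 'a \<Rightarrow> enat" where
  "gdist G u v = (INF n \<in> {n. (G ^^ n) u v}. enat n)"

definition nbhd :: "'a graph \<Rightarrow> 'a \<Rightarrow> nat \<Rightarrow> 'a set" where
  "nbhd G v i = {u. gdist G v u \<le> enat i}"

lemma nbhd_iff_walk: "u \<in> nbhd G v i \<longleftrightarrow> (\<exists>n\<le>i. (G ^^ n) v u)"
proof -
  have "gdist G v u \<le> enat i \<longleftrightarrow> gdist G v u < enat (Suc i)"
    by (cases "gdist G v u") auto
  then show ?thesis
    by (auto simp: nbhd_def gdist_def INF_less_iff less_Suc_eq_le)
qed

subsection \<open>The firefighter game\<close>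

text \<open>
  A play is described by the sets \<open>P t\<close> of the vertices protected in the turns \<open>t \<ge> 1\<close>; the value
  \<open>P 0\<close> is irrelevant. The sets below give the state of the game after turn \<open>t\<close>.
\<close>

definition protected_by :: "(nat \<Rightarrow> 'a set) \<Rightarrow> nat \<Rightarrow> 'a set" where
  "protected_by P t = (\<Union>s\<in>{1..t}. P s)"

primrec burning :: "'a graph \<Rightarrow> 'a \<Rightarrow> (nat \<Rightarrow> 'a set) \<Rightarrow> nat \<Rightarrow> 'a set" where
  "burning G v P 0 = {v}"
| "burning G v P (Suc t) = burning G v P t
     \<union> {u. (\<exists>w\<in>burning G v P t. G w u) \<and> u \<notin> protected_by P (Suc t)}"

text \<open>
  Here \<open>e t\<close> is the number of extra protections in turn \<open>t\<close>. An extra protection that is not used in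
  its turn is lost. Choosing an already protected vertex again is allowed (and has no effect).
\<close>

definition legal_play :: "'a graph \<Rightarrow> 'a \<Rightarrow> (nat \<Rightarrow> nat) \<Rightarrow> (nat \<Rightarrow> 'a set) \<Rightarrow> bool" where
  "legal_play G v e P \<longleftrightarrow>
     (\<forall>t\<ge>1. 1 \<le> card (P t) \<and> card (P t) \<le> 1 + e t \<and> P t \<inter> burning G v P (t - 1) = {})"

definition contains_fire :: "'a graph \<Rightarrow> 'a \<Rightarrow> (nat \<Rightarrow> 'a set) \<Rightarrow> bool" where
  "contains_fire G v P \<longleftrightarrow>
     (\<exists>T. \<forall>t\<ge>T. \<forall>w\<in>burning G v P t. \<forall>u. G w u \<longrightarrow> u \<in> burning G v P t \<or> u \<in> protected_by P t)"

subsection \<open>The surviving rate\<close>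

definition saved :: "'a graph \<Rightarrow> 'a \<Rightarrow> (nat \<Rightarrow> 'a set) \<Rightarrow> 'a set" where
  "saved G v P = {u. \<forall>t. u \<notin> burning G v P t}"

definition surviving_rate_of :: "'a graph \<Rightarrow> 'a \<Rightarrow> (nat \<Rightarrow> 'a set) \<Rightarrow> ereal" where
  "surviving_rate_of G v P =
     liminf (\<lambda>i. ereal (real (card (nbhd G v i \<inter> saved G v P)) / real (card (nbhd G v i))))"

text \<open>
  Without extra protections the game has no uncertainty, so that a deterministic strategy is the same
  as a legal play.
\<close>

definition surviving_rate :: "'a graph \<Rightarrow> 'a \<Rightarrow> ereal" where
  "surviving_rate G v = (SUP P\<in>{P. legal_play G v (\<lambda>_. 0) P}. surviving_rate_of G v P)"

subsection \<open>Two extra protections and online strategies\<close>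

definition extra_at :: "nat \<Rightarrow> nat \<Rightarrow> nat \<Rightarrow> nat" where
  "extra_at t\<^sub>1 t\<^sub>2 t = of_bool (t = t\<^sub>1) + of_bool (t = t\<^sub>2)"

text \<open>
  An online strategy maps the list \<open>[e 1, \<dots>, e t]\<close> of the numbers of extra protections that have become
  available in the turns up to \<open>t\<close> to the set of vertices to be protected in turn \<open>t\<close>. As the fire is
  deterministic, this list determines the entire history of the game.
\<close>

type_synonym 'a online_strategy = "nat list \<Rightarrow> 'a set"

definition play_of :: "'a online_strategy \<Rightarrow> (nat \<Rightarrow> nat) \<Rightarrow> nat \<Rightarrow> 'a set" where
  "play_of \<sigma> e t = \<sigma> (map e [1..<Suc t])"

end

theory Submission imports Defs begin

text \<open>
  A fire that follows a straight zigzag of the grid alternately turns left and right. A wall on its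
  left has to block one vertex at each right turn, that is, one vertex in every second turn of the
  game. One protection per turn therefore keeps pace with the fire at both ends of a wall. With the
  parities of the grid this yields a wall with two straight arms that enclose an angle of 120
  degrees, one arm being extended in the odd turns and the other in the even turns. The fire stays
  in this wedge. Up to a path, three copies of the wedge, rotated about the origin of the fire, are
  disjoint, so the wedge has at most one third of each ball, asymptotically. This is the bound on
  the surviving rate (\<open>surviving_rate_of_wedge\<close>).

  To contain the fire, the same wedge is built until the first extra protection arrives, say in turn
  \<open>\<tau>\<close>. Bending an arm by 60 degrees towards the fire shifts the parity of the turns in which this
  arm needs a protection. If both arms are bent at the same time, two protections are due in turn
  \<open>\<tau>\<close> and again a single one in every later turn. The arms are now parallel: the fire runs along a
  strip whose width is less than \<open>\<tau>\<close> and which can be continued at will. When its length is a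
  sufficient multiple of \<open>\<tau>\<close>, the left arm is given up. The right arm then receives a vertex
  in every turn, so it advances at twice the speed of the fire. It bends to the left, crosses the
  strip ahead of the fire and winds around the free end of the left arm. Each further bend costs a
  larger radius, but all radii are fixed multiples of the width of the strip; if the strip is long
  enough, the wall comes back to the foot of the left arm, from behind, before the fire does. The
  region so enclosed is finite.

  The burning set is never computed. Both plays are verified by a certificate: a region together with
  a lower bound for the time at which fire can reach each vertex of it
  (\<open>burning_subset_certified\<close>). These bounds are maxima of linear forms in the coordinates, so
  that only linear inequalities remain. As the graph is vertex-transitive, a single starting vertex
  suffices.
\<close>

section \<open>Certificates\<close>

text \<open>
  The function \<open>f\<close> is a lower bound for arrival times. Along an edge that stays in \<open>D\<close> it grows by
  at most 1, and an edge that leaves \<open>D\<close> ends in a vertex that is protected by the time when the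
  fire could use this edge.
\<close>

lemma burning_subset_certified:
  fixes f :: "'a \<Rightarrow> int"
  assumes "v \<in> D" "f v \<le> 0"
    and step: "\<And>u u'. u \<in> D \<Longrightarrow> G u u' \<Longrightarrow>
      u' \<in> D \<and> f u' \<le> f u + 1 \<or> (\<exists>s\<ge>1. int s \<le> f u + 1 \<and> u' \<in> P s)"
  shows "burning G v P t \<subseteq> {u \<in> D. f u \<le> int t}"
proof (induction t)
  case 0
  then show ?case using assms(1,2) by simp
next
  case (Suc t)
  have "u' \<in> D \<and> f u' \<le> int (Suc t)"
    if w: "w \<in> burning G v P t" "G w u'" "u' \<notin> protected_by P (Suc t)" for w u'
  proof -
    have "w \<in> D" "f w \<le> int t" using w(1) Suc.IH by auto
    moreover have "u' \<notin> P s" if "1 \<le> s" "int s \<le> f w + 1" for s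
      using that \<open>f w \<le> int t\<close> w(3) by (auto simp: protected_by_def)
    ultimately show ?thesis using step[OF _ w(2)] by fastforce
  qed
  then show ?case using Suc.IH by fastforce
qed

lemma burning_mono: "s \<le> t \<Longrightarrow> burning G v P s \<subseteq> burning G v P t"
  by (induction t rule: dec_induct) auto

text \<open>
  The burning sets increase, so in a finite set they become constant; from then on, a vertex without
  protection next to the fire would have to burn one turn later and thus burns already.
\<close>

lemma contains_fire_if_finite:
  assumes "finite D" "\<And>t. burning G v P t \<subseteq> D"
  shows "contains_fire G v P"
proof -
  let ?U = "\<Union>(range (burning G v P))"
  have "\<exists>T. A \<subseteq> burning G v P T" if "finite A" "A \<subseteq> ?U" for A
    using that
  proof (induction A)
    case (insert x A)
    then obtain T s where "A \<subseteq> burning G v P T" "x \<in> burning G v P s" by auto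
    then have "insert x A \<subseteq> burning G v P (max s T)"
      using burning_mono[of s "max s T" G v P] burning_mono[of T "max s T" G v P] by auto
    then show ?case by blast
  qed simp
  moreover have "finite ?U" using assms by (meson UN_least finite_subset)
  ultimately obtain T where "?U \<subseteq> burning G v P T" by blast
  then have T: "burning G v P t \<subseteq> burning G v P T" for t by blast
  show ?thesis
    unfolding contains_fire_def
  proof (intro exI[of _ "Suc T"] allI impI ballI)
    fix t w u assume t: "Suc T \<le> t" and w: "w \<in> burning G v P t" and "G w u"
    then obtain t' where t': "t = Suc t'" "T \<le> t'" by (cases t) auto
    then have "w \<in> burning G v P t'" using T[of t] burning_mono[of T t' G v P] w by blast
    then show "u \<in> burning G v P t \<or> u \<in> protected_by P t" using \<open>G w u\<close> t' by auto
  qed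
qed

section \<open>Automorphisms\<close>

definition automorphism :: "'a graph \<Rightarrow> ('a \<Rightarrow> 'a) \<Rightarrow> bool" where
  "automorphism G \<pi> \<longleftrightarrow> bij \<pi> \<and> (\<forall>x y. G (\<pi> x) (\<pi> y) \<longleftrightarrow> G x y)"

lemma set_eqI_bij:
  assumes "bij \<pi>" "\<And>x. \<pi> x \<in> A \<longleftrightarrow> \<pi> x \<in> B"
  shows "A = B"
proof (rule set_eqI)
  fix y
  obtain x where "y = \<pi> x" using assms(1) by (metis bij_pointE)
  then show "y \<in> A \<longleftrightarrow> y \<in> B" using assms(2) by simp
qed

lemma automorphism_burning:
  assumes "automorphism G \<pi>"
  shows "burning G (\<pi> v) (\<lambda>t. \<pi> ` P t) t = \<pi> ` burning G v P t"
proof (induction t)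
  case (Suc t)
  have prot: "protected_by (\<lambda>t. \<pi> ` P t) (Suc t) = \<pi> ` protected_by P (Suc t)"
    by (auto simp: protected_by_def)
  have bij: "bij \<pi>" and G: "G (\<pi> x) (\<pi> y) \<longleftrightarrow> G x y" for x y
    using assms by (auto simp: automorphism_def)
  have "{u. (\<exists>w\<in>\<pi> ` B. G w u) \<and> u \<notin> \<pi> ` R}
      = \<pi> ` {u. (\<exists>w\<in>B. G w u) \<and> u \<notin> R}" (is "?L = ?R") for B R
  proof -
    have "\<pi> x \<in> ?L \<longleftrightarrow> \<pi> x \<in> ?R" for x
      using bij by (auto simp: G inj_image_mem_iff bij_is_inj)
    then show ?thesis by (rule set_eqI_bij[OF bij])
  qed
  then show ?case by (simp only: burning.simps prot Suc.IH image_Un)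
qed simp

lemma automorphism_legal_play:
  assumes "automorphism G \<pi>" "legal_play G v e P"
  shows "legal_play G (\<pi> v) e (\<lambda>t. \<pi> ` P t)"
proof -
  have inj: "inj \<pi>" using assms(1) by (simp add: automorphism_def bij_is_inj)
  then have "card (\<pi> ` A) = card A" for A by (simp add: card_image inj_on_subset)
  then show ?thesis
    using assms(2) unfolding legal_play_def automorphism_burning[OF assms(1)]
    by (simp add: image_Int[OF inj, symmetric])
qed

lemma automorphism_contains_fire:
  assumes "automorphism G \<pi>" "contains_fire G v P"
  shows "contains_fire G (\<pi> v) (\<lambda>t. \<pi> ` P t)"
proof -
  have prot: "protected_by (\<lambda>t. \<pi> ` P t) t = \<pi> ` protected_by P t" for t
    by (auto simp: protected_by_def)
  have bij: "bij \<pi>" and G: "G (\<pi> x) (\<pi> y) \<longleftrightarrow> G x y" for x y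
    using assms by (auto simp: automorphism_def)
  obtain T where T: "\<And>t w u. t \<ge> T \<Longrightarrow> w \<in> burning G v P t \<Longrightarrow> G w u \<Longrightarrow>
      u \<in> burning G v P t \<or> u \<in> protected_by P t"
    using assms(2) unfolding contains_fire_def by blast
  show ?thesis
    unfolding contains_fire_def automorphism_burning[OF assms(1)] prot
  proof (intro exI[of _ T] allI impI ballI)
    fix t w u assume "t \<ge> T" "w \<in> \<pi> ` burning G v P t" "G w u"
    moreover obtain u0 where u0: "u = \<pi> u0" using bij by (metis bij_pointE)
    ultimately obtain w0 where "w0 \<in> burning G v P t" "G w0 u0" by (auto simp: G)
    then have "u0 \<in> burning G v P t \<or> u0 \<in> protected_by P t" using T[OF \<open>t \<ge> T\<close>] by blast
    then show "u \<in> \<pi> ` burning G v P t \<or> u \<in> \<pi> ` protected_by P t" using u0 by blast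
  qed
qed

lemma automorphism_nbhd:
  assumes "automorphism G \<pi>"
  shows "nbhd G (\<pi> v) i = \<pi> ` nbhd G v i"
proof -
  have bij: "bij \<pi>" and G: "G (\<pi> x) (\<pi> y) \<longleftrightarrow> G x y" for x y
    using assms by (auto simp: automorphism_def)
  have walk: "(G ^^ n) (\<pi> x) (\<pi> y) \<longleftrightarrow> (G ^^ n) x y" for n x y
  proof (induction n arbitrary: y)
    case 0
    then show ?case using bij by (simp add: bij_is_inj inj_eq)
  next
    case (Suc n)
    have "(\<exists>z. (G ^^ n) (\<pi> x) z \<and> G z (\<pi> y)) \<longleftrightarrow> (\<exists>z. (G ^^ n) (\<pi> x) (\<pi> z) \<and> G (\<pi> z) (\<pi> y))"
      using bij by (metis bij_pointE)
    then show ?case using Suc.IH by (simp add: relcompp_apply G)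
  qed
  have "\<pi> x \<in> nbhd G (\<pi> v) i \<longleftrightarrow> \<pi> x \<in> \<pi> ` nbhd G v i" for x
    using bij by (simp add: nbhd_iff_walk walk inj_image_mem_iff bij_is_inj)
  then show ?thesis by (rule set_eqI_bij[OF bij])
qed

lemma automorphism_surviving_rate_of:
  assumes "automorphism G \<pi>"
  shows "surviving_rate_of G (\<pi> v) (\<lambda>t. \<pi> ` P t) = surviving_rate_of G v P"
proof -
  have bij: "bij \<pi>" using assms by (auto simp: automorphism_def)
  then have inj: "inj \<pi>" by (rule bij_is_inj)
  have card: "card (\<pi> ` A) = card A" for A using inj by (simp add: card_image inj_on_subset)
  have "\<pi> x \<in> saved G (\<pi> v) (\<lambda>t. \<pi> ` P t) \<longleftrightarrow> \<pi> x \<in> \<pi> ` saved G v P" for x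
    using inj by (simp add: saved_def automorphism_burning[OF assms] inj_image_mem_iff)
  then have "saved G (\<pi> v) (\<lambda>t. \<pi> ` P t) = \<pi> ` saved G v P"
    by (rule set_eqI_bij[OF bij])
  then show ?thesis
    unfolding surviving_rate_of_def
    by (simp add: automorphism_nbhd[OF assms] image_Int[OF inj, symmetric] card)
qed

text \<open>
  The translations move \<open>(0, 0, False)\<close> to all vertices of its class, and the point reflections
  move it to all vertices of the other class.
\<close>

fun hex_move :: "hex_vertex \<Rightarrow> hex_vertex \<Rightarrow> hex_vertex" where
  "hex_move (k, l, c) (i, j, b) = (if c then (k - i, l - j, \<not> b) else (k + i, l + j, b))"

abbreviation hex_origin :: hex_vertex where "hex_origin \<equiv> (0, 0, False)"

lemma hex_move_origin: "hex_move v hex_origin = v"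
proof -
  obtain k l c where "v = (k, l, c)" by (metis prod_cases3)
  then show ?thesis by (cases c) simp_all
qed

lemma automorphism_hex_move: "automorphism hex_adj (hex_move v)"
proof -
  obtain k l c where v: "v = (k, l, c)" by (metis prod_cases3)
  have inj: "inj (hex_move v)"
    by (rule injI, cases c) (auto simp: v)
  have surj: "\<exists>x. hex_move v x = (i, j, b)" for i j b
  proof (cases c)
    case True
    then have "hex_move v (k - i, l - j, \<not> b) = (i, j, b)" by (simp add: v)
    then show ?thesis ..
  next
    case False
    then have "hex_move v (i - k, j - l, b) = (i, j, b)" by (simp add: v)
    then show ?thesis ..
  qed
  have adj: "hex_adj (hex_move v p) (hex_move v q) = hex_adj p q" for p q
    by (cases "(p, q)" rule: hex_adj.cases; cases c) (auto simp: v)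
  have "surj (hex_move v)" unfolding surj_def using surj by (metis prod_cases3)
  then show ?thesis using inj adj by (simp add: automorphism_def bij_def)
qed

section \<open>The wedge\<close>

text \<open>
  The lattice directions of the two coordinates enclose an angle of 60 degrees. The wedge has its
  apex at the origin, and its axis points in the second direction. Left and right refer to a viewer
  who looks in that direction: the left wall runs in the first direction and is extended in the odd
  turns, the right wall is extended in the even turns.
\<close>

definition wedge_move :: "nat \<Rightarrow> hex_vertex" where
  "wedge_move t = (if odd t then (int t div 2, - 1, True) else (- (int t div 2), int t div 2 - 1, False))"

definition wedge :: "hex_vertex set" where
  "wedge = {(i, j, b). 0 \<le> j \<and> 0 \<le> i + j + of_bool b}"

text \<open>
  If \<open>x\<close> is one of \<open>i\<close>, \<open>j\<close> and \<open>i + j\<close>, then \<open>2 * x + of_bool b\<close> differs by exactly 1 between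
  adjacent vertices \<open>(i, j, b)\<close>. All bounds for arrival times below are maxima of such forms and
  their negatives, shifted by constants.
\<close>

definition wedge_arrival :: "hex_vertex \<Rightarrow> int" where
  "wedge_arrival = (\<lambda>(i, j, b). max (2 * j) (2 * (i + j)) + of_bool b)"

lemma wedge_left_wall: "0 \<le> k \<Longrightarrow> wedge_move (nat (2 * k + 1)) = (k, - 1, True)"
  by (auto simp: wedge_move_def even_nat_iff)

lemma wedge_right_wall: "0 \<le> k \<Longrightarrow> wedge_move (nat (2 * k + 2)) = (- k - 1, k, False)"
  by (auto simp: wedge_move_def even_nat_iff)

text \<open>
  The wall vertices \<open>(k, - 1, True)\<close> and \<open>(- k - 1, k, False)\<close> can be reached through a single
  vertex of the wedge, with arrival times \<open>2 * k\<close> and \<open>2 * k + 1\<close>. They are protected just in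
  time.
\<close>

lemma wedge_certificate:
  assumes "u \<in> wedge" "hex_adj u u'"
  shows "u' \<in> wedge \<and> wedge_arrival u' \<le> wedge_arrival u + 1 \<or>
    (\<exists>s\<ge>1. int s \<le> wedge_arrival u + 1 \<and> u' \<in> {wedge_move s})"
proof -
  have left: "\<exists>s\<ge>1. int s \<le> d \<and> (k, - 1, True) = wedge_move s" if "0 \<le> k" "2 * k + 1 \<le> d" for k d
    using that by (intro exI[of _ "nat (2 * k + 1)"]) (simp add: wedge_left_wall)
  have right: "\<exists>s\<ge>1. int s \<le> d \<and> (- k - 1, k, False) = wedge_move s" if "0 \<le> k" "2 * k + 2 \<le> d" for k d
    using that by (intro exI[of _ "nat (2 * k + 2)"]) (simp add: wedge_right_wall)
  show ?thesis
  proof (cases "(u, u')" rule: hex_adj.cases)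
    case (1 i j k l)
    then have "0 \<le> j" "0 \<le> i + j" and kl: "(k, l) \<in> {(i, j), (i - 1, j), (i, j - 1)}"
      using assms by (auto simp: wedge_def)
    show ?thesis
    proof (cases "j = 0 \<and> l = j - 1")
      case True
      then show ?thesis
        using left[of i "wedge_arrival u + 1"] 1 kl \<open>0 \<le> i + j\<close> by (auto simp: wedge_arrival_def)
    next
      case False
      then show ?thesis
        using 1 kl \<open>0 \<le> j\<close> \<open>0 \<le> i + j\<close> by (auto simp: wedge_def wedge_arrival_def)
    qed
  next
    case (2 k l i j)
    then have "0 \<le> l" "0 \<le> k + l + 1" and kl: "(k, l) \<in> {(i, j), (i - 1, j), (i, j - 1)}"
      using assms by (auto simp: wedge_def)
    show ?thesis
    proof (cases "i + j = - 1")
      case True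
      then have "i = - l - 1" "j = l" "k = - l - 1" using kl \<open>0 \<le> k + l + 1\<close> by auto
      then show ?thesis
        using right[of l "wedge_arrival u + 1"] 2 \<open>0 \<le> l\<close> by (auto simp: wedge_arrival_def)
    next
      case False
      then show ?thesis
        using 2 kl \<open>0 \<le> l\<close> \<open>0 \<le> k + l + 1\<close> by (auto simp: wedge_def wedge_arrival_def)
    qed
  qed (use assms in auto)
qed

lemma burning_subset_wedge:
  "burning hex_adj hex_origin (\<lambda>t. {wedge_move t}) t \<subseteq> wedge"
  using burning_subset_certified[of hex_origin wedge wedge_arrival hex_adj "\<lambda>t. {wedge_move t}" t]
    wedge_certificate by (auto simp: wedge_def wedge_arrival_def)

lemma legal_play_wedge: "legal_play hex_adj hex_origin (\<lambda>_. 0) (\<lambda>t. {wedge_move t})"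
proof -
  have "wedge_move t \<notin> wedge" for t by (auto simp: wedge_move_def wedge_def)
  then show ?thesis using burning_subset_wedge unfolding legal_play_def by fastforce
qed

section \<open>The surviving rate of the wedge strategy\<close>

text \<open>The rotation by 120 degrees about the vertex \<open>(0, 0, False)\<close>.\<close>

fun hex_rotate :: "hex_vertex \<Rightarrow> hex_vertex" where
  "hex_rotate (i, j, b) = (j, - i - j - of_bool b, b)"

lemma automorphism_hex_rotate: "automorphism hex_adj hex_rotate"
proof -
  have "inj hex_rotate" by (rule injI) auto
  moreover have "\<exists>x. hex_rotate x = (i, j, b)" for i j b
    by (rule exI[of _ "(- i - j - of_bool b, i, b)"]) simp
  then have "surj hex_rotate" unfolding surj_def by (metis prod_cases3)
  moreover have "hex_adj (hex_rotate p) (hex_rotate q) = hex_adj p q" for p q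
    by (cases "(p, q)" rule: hex_adj.cases) auto
  ultimately show ?thesis by (simp add: automorphism_def bij_def)
qed

lemma finite_nbhd_hex: "finite (nbhd hex_adj v i)"
proof -
  have deg: "finite {u. hex_adj w u}" for w
  proof -
    obtain k l c where w: "w = (k, l, c)" by (metis prod_cases3)
    have "{u. hex_adj w u} \<subseteq> {k - 1..k + 1} \<times> {l - 1..l + 1} \<times> UNIV"
    proof
      fix u assume "u \<in> {u. hex_adj w u}"
      then have "hex_adj w u" by simp
      then show "u \<in> {k - 1..k + 1} \<times> {l - 1..l + 1} \<times> UNIV"
        unfolding w by (cases "((k, l, c), u)" rule: hex_adj.cases) auto
    qed
    then show ?thesis by (rule finite_subset) simp
  qed
  have "finite {u. (hex_adj ^^ n) v u}" for n
  proof (induction n)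
    case (Suc n)
    have "{u. (hex_adj ^^ Suc n) v u} = (\<Union>w\<in>{u. (hex_adj ^^ n) v u}. {u. hex_adj w u})"
      by auto
    then show ?case using Suc.IH deg by simp
  qed simp
  moreover have "nbhd hex_adj v i = (\<Union>n\<le>i. {u. (hex_adj ^^ n) v u})"
    by (auto simp: nbhd_iff_walk)
  ultimately show ?thesis by simp
qed

lemma hex_walk_abs_le: "(hex_adj ^^ n) hex_origin (i, j, b) \<Longrightarrow> \<bar>i\<bar> \<le> int n"
proof (induction n arbitrary: i j b)
  case (Suc n)
  then obtain k l c where "(hex_adj ^^ n) hex_origin (k, l, c)" and "hex_adj (k, l, c) (i, j, b)"
    by (auto elim!: relpowp_Suc_E)
  moreover from this(2) have "\<bar>i - k\<bar> \<le> 1"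
    by (cases "((k, l, c), (i, j, b))" rule: hex_adj.cases) auto
  ultimately show ?case using Suc.IH by fastforce
qed simp

text \<open>
  Balls grow quadratically, so the linear overlap of the rotated wedges does not matter in the limit.
\<close>

lemma card_nbhd_ge: "(i div 4) ^ 2 \<le> card (nbhd hex_adj hex_origin i)"
proof -
  let ?q = "i div 4"
  have right: "(hex_adj ^^ (2 * a)) (i, j, False) (i + int a, j, False)" for a i j
  proof (induction a)
    case (Suc a)
    have "hex_adj (i + int a, j, False) (i + int a, j, True)"
      "hex_adj (i + int a, j, True) (i + int (Suc a), j, False)" by simp_all
    then show ?case using Suc.IH relpowp_Suc_I by fastforce
  qed simp
  have up: "(hex_adj ^^ (2 * a)) (i, j, False) (i, j + int a, False)" for a i j
  proof (induction a)
    case (Suc a)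
    have "hex_adj (i, j + int a, False) (i, j + int a, True)"
      "hex_adj (i, j + int a, True) (i, j + int (Suc a), False)" by simp_all
    then show ?case using Suc.IH relpowp_Suc_I by fastforce
  qed simp
  let ?g = "\<lambda>(a, b). (int a, int b, False)"
  have "?g ` ({..<?q} \<times> {..<?q}) \<subseteq> nbhd hex_adj hex_origin i"
  proof clarify
    fix a b assume "a < ?q" "b < ?q"
    then have "2 * a + 2 * b \<le> i" by auto
    moreover have "(hex_adj ^^ (2 * a + 2 * b)) hex_origin (int a, int b, False)"
      using right[of a 0 0] up[of b "int a" 0] unfolding relpowp_add by auto
    ultimately show "(int a, int b, False) \<in> nbhd hex_adj hex_origin i"
      unfolding nbhd_iff_walk by blast
  qed
  moreover have "card (?g ` ({..<?q} \<times> {..<?q})) = ?q ^ 2"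
    by (subst card_image) (auto simp: inj_on_def power2_eq_square)
  ultimately show ?thesis using card_mono[OF finite_nbhd_hex] by metis
qed

text \<open>
  Without its boundary row \<open>j = 0\<close>, the wedge is disjoint from its images under the two rotations,
  which preserve the ball; so it has at most one third of the ball.
\<close>

lemma card_nbhd_Int_wedge:
  "3 * card (nbhd hex_adj hex_origin i \<inter> wedge) \<le> card (nbhd hex_adj hex_origin i) + 6 * (i + 2)"
proof -
  let ?N = "nbhd hex_adj hex_origin i"
  let ?\<rho> = hex_rotate
  define W where "W = ?N \<inter> {(i, j, b). 1 \<le> j \<and> 0 \<le> i + j + of_bool b}"
  define row where "row = {- 1..int i} \<times> {0::int} \<times> (UNIV :: bool set)"
  have inj: "inj ?\<rho>" using automorphism_hex_rotate by (simp add: automorphism_def bij_def)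
  have rot: "?\<rho> ` ?N = ?N"
    using automorphism_nbhd[OF automorphism_hex_rotate, of hex_origin i] by simp
  have fin: "finite W" "finite (?\<rho> ` W)" "finite (?\<rho> ` ?\<rho> ` W)"
    by (simp_all add: W_def finite_nbhd_hex)
  have card: "card (?\<rho> ` W) = card W" "card (?\<rho> ` ?\<rho> ` W) = card W"
    using inj by (simp_all add: card_image inj_on_subset)
  have "W \<inter> ?\<rho> ` W = {}" "(W \<union> ?\<rho> ` W) \<inter> ?\<rho> ` ?\<rho> ` W = {}"
    by (auto simp: W_def of_bool_def split: if_splits)
  then have "card (W \<union> ?\<rho> ` W \<union> ?\<rho> ` ?\<rho> ` W) = 3 * card W"
    using fin by (simp add: card_Un_disjoint card)
  moreover have "W \<union> ?\<rho> ` W \<union> ?\<rho> ` ?\<rho> ` W \<subseteq> ?N"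
    using rot by (auto simp: W_def)
  ultimately have W: "3 * card W \<le> card ?N" using card_mono[OF finite_nbhd_hex] by metis
  have "?N \<inter> wedge \<subseteq> W \<union> row"
  proof
    fix u assume u: "u \<in> ?N \<inter> wedge"
    obtain k l c where kl: "u = (k, l, c)" by (metis prod_cases3)
    obtain n where "n \<le> i" "(hex_adj ^^ n) hex_origin (k, l, c)"
      using u by (auto simp: nbhd_iff_walk kl)
    then have "\<bar>k\<bar> \<le> int i" using hex_walk_abs_le by fastforce
    then show "u \<in> W \<union> row" using u by (auto simp: W_def row_def wedge_def kl of_bool_def split: if_splits)
  qed
  then have "card (?N \<inter> wedge) \<le> card (W \<union> row)"
    using fin by (intro card_mono) (simp_all add: row_def)
  also have "\<dots> \<le> card W + card row" by (rule card_Un_le)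
  also have "card row = 2 * (i + 2)" by (simp add: row_def)
  finally show ?thesis using W by linarith
qed

lemma surviving_rate_of_wedge:
  "ereal (2 / 3) \<le> surviving_rate_of hex_adj hex_origin (\<lambda>t. {wedge_move t})"
proof -
  let ?N = "nbhd hex_adj hex_origin" and ?S = "saved hex_adj hex_origin (\<lambda>t. {wedge_move t})"
  have S: "- wedge \<subseteq> ?S" using burning_subset_wedge by (auto simp: saved_def)
  have ratio: "2 / 3 - 256 / real i \<le> real (card (?N i \<inter> ?S)) / real (card (?N i))" if "8 \<le> i" for i
  proof -
    have "card (?N i) = card (?N i \<inter> wedge) + card (?N i - wedge)"
      using finite_nbhd_hex by (simp add: card_Diff_subset_Int card_mono)
    moreover have "card (?N i - wedge) \<le> card (?N i \<inter> ?S)"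
      using S finite_nbhd_hex by (intro card_mono) auto
    ultimately have 1: "2 * card (?N i) \<le> 3 * card (?N i \<inter> ?S) + 6 * (i + 2)"
      using card_nbhd_Int_wedge[of i] by linarith
    have "real i / 8 \<le> real (i div 4)" using that by linarith
    then have "(real i / 8) ^ 2 \<le> real (i div 4) ^ 2" by (intro power_mono) simp_all
    also have "\<dots> \<le> real (card (?N i))" using card_nbhd_ge[of i] by (metis of_nat_le_iff of_nat_power)
    finally have 2: "real i * real i \<le> 64 * real (card (?N i))"
      by (simp add: power2_eq_square)
    then have pos: "0 < real (card (?N i))" using that
      by (smt (verit) mult_pos_pos of_nat_0_less_iff zero_less_numeral order_less_le_trans)
    have "2 * real (i + 2) \<le> 4 * real i" using that by simp
    also have "4 * real i = 4 * (real i * real i) / real i" using that by simp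
    also have "\<dots> \<le> 4 * (64 * real (card (?N i))) / real i"
      using 2 by (intro divide_right_mono mult_left_mono) simp_all
    finally have "2 * real (i + 2) \<le> 256 / real i * real (card (?N i))" by simp
    moreover have "2 * real (card (?N i)) \<le> 3 * real (card (?N i \<inter> ?S)) + 6 * real (i + 2)"
      using 1 by linarith
    ultimately show ?thesis using pos by (simp add: pos_le_divide_eq left_diff_distrib)
  qed
  have lim: "(\<lambda>i. ereal (2 / 3 - 256 / real i)) \<longlonglongrightarrow> ereal (2 / 3 - 0)"
    by (intro tendsto_intros lim_const_over_n)
  have "ereal (2 / 3) = liminf (\<lambda>i. ereal (2 / 3 - 256 / real i))"
    unfolding lim_imp_Liminf[OF sequentially_bot lim] by simp
  also have "\<dots> \<le> surviving_rate_of hex_adj hex_origin (\<lambda>t. {wedge_move t})"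
    unfolding surviving_rate_of_def
    by (rule Liminf_mono, rule eventually_sequentiallyI[of 8]) (simp add: ratio)
  finally show ?thesis .
qed

section \<open>Closing the wedge\<close>

text \<open>
  Here \<open>\<tau>\<close> is the turn of the first extra protection. The two walls are bent at the first
  coordinates \<open>left_corner \<tau>\<close> and \<open>- right_corner \<tau>\<close>, which bound the strip. The rounding
  makes the last regular step of the one wall and the first step after the bend of the other
  wall fall into turn \<open>\<tau>\<close>, whatever the parity of \<open>\<tau>\<close>.
\<close>

definition left_corner :: "nat \<Rightarrow> int" where "left_corner \<tau> = (int \<tau> - 1) div 2"
definition right_corner :: "nat \<Rightarrow> int" where "right_corner \<tau> = int \<tau> div 2"

lemma corners:
  assumes "1 \<le> \<tau>"
  shows "left_corner \<tau> + right_corner \<tau> = int \<tau> - 1" "left_corner \<tau> \<le> right_corner \<tau>"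
    "right_corner \<tau> \<le> left_corner \<tau> + 1" "0 \<le> left_corner \<tau>"
  using assms unfolding left_corner_def right_corner_def by presburger+

text \<open>
  The first case is the strip: the left wall is extended in the even turns and the right wall in the
  odd turns. When the left wall ends, at \<open>j = 8 * \<tau>\<close>, the right wall is continued by one vertex per
  turn, along the strip up to \<open>j = 9 * \<tau>\<close>, then bending to the left by 60 degrees each time and
  following the lines \<open>j = 9 * \<tau>\<close>, \<open>i + j = 10 * \<tau>\<close>, \<open>i = 4 * \<tau>\<close> and \<open>j = - 1\<close>. The last line is
  the one that carries the left wall of the wedge.

  The multiples are found from the inside outwards. The fire meets a part of each side
  simultaneously, because this part is parallel to a flat front. So each side must be far enough from the
  end of the left wall to let the wall gain that many turns on the preceding sides. The last side
  fixes the length of the strip.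
\<close>

definition closing_move :: "nat \<Rightarrow> int \<Rightarrow> hex_vertex" where
  "closing_move \<tau> s =
     (if s \<le> 2 * left_corner \<tau> + 16 * int \<tau> then
        if even s then (left_corner \<tau> + 1, s div 2 - 1 - left_corner \<tau>, False)
        else (- right_corner \<tau> - 1, s div 2, True)
      else if s \<le> left_corner \<tau> + 17 * int \<tau> then (- right_corner \<tau> - 1, s - 1 - left_corner \<tau> - 8 * int \<tau>, True)
      else if s \<le> 19 * int \<tau> then (s - 18 * int \<tau>, 9 * int \<tau>, False)
      else if s < 22 * int \<tau> then (s - 18 * int \<tau>, 28 * int \<tau> - s, True)
      else if s \<le> 28 * int \<tau> then (4 * int \<tau>, 28 * int \<tau> - s, False)
      else (32 * int \<tau> - s, - 1, True))"

text \<open>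
  In turn \<open>\<tau>\<close> both walls receive a vertex. The moves before turn \<open>\<tau>\<close> do not depend on \<open>\<tau>\<close>.
\<close>

definition moves :: "nat \<Rightarrow> nat \<Rightarrow> hex_vertex set" where
  "moves \<tau> t =
     (if t \<le> \<tau> then {wedge_move t} else {}) \<union> (if \<tau> \<le> t then {closing_move \<tau> (int t)} else {})"

text \<open>
  A hexagonal region with a slit: the vertices \<open>(left_corner \<tau> + 1, j, False)\<close> with \<open>j < 8 * \<tau>\<close>
  form the left wall of the strip, which the fire reaches from both sides. The summands \<open>of_bool b\<close>
  are chosen such that every vertex outside that is next to a side has a single neighbour inside
  across that side.
\<close>

definition region :: "nat \<Rightarrow> hex_vertex set" where
  "region \<tau> = {(i, j, b). - right_corner \<tau> \<le> i \<and> i < 4 * int \<tau> \<and> 0 \<le> j \<and> j < 9 * int \<tau> \<and>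
     0 \<le> i + j + of_bool b \<and> i + j + of_bool b \<le> 10 * int \<tau> \<and>
     \<not> (i = left_corner \<tau> + 1 \<and> j < 8 * int \<tau> \<and> \<not> b)}"

text \<open>
  On the near side of the slit the bound is the distance in the wedge. Behind the slit the fire comes
  through the gap at its end, the vertex \<open>(left_corner \<tau> + 1, 8 * \<tau>, False)\<close>, where the three
  forms of the second case agree; their maximum is the arrival time at this vertex plus the distance
  from it. Beyond the end of the slit, where the two sides are adjacent, the form in \<open>i + j\<close>
  is the largest on both, so that there is no jump.
\<close>

definition arrival :: "nat \<Rightarrow> hex_vertex \<Rightarrow> int" where
  "arrival \<tau> = (\<lambda>(i, j, b).
     if i \<le> left_corner \<tau> then max (2 * j) (2 * (i + j)) + of_bool b
     else max (max (2 * (i + j)) (2 * (i + 8 * int \<tau>)) + of_bool b)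
       (32 * int \<tau> + 2 * left_corner \<tau> + 2 - 2 * j - of_bool b))"

context
  fixes \<tau> :: nat
  assumes \<tau>: "1 \<le> \<tau>"
begin

private abbreviation "n \<equiv> left_corner \<tau>"
private abbreviation "m \<equiv> right_corner \<tau>"

text \<open>
  The walls of the wedge, those of the strip (the right one first at the pace of the fire and then
  at full pace), and the remaining sides of the spiral, with the turns in which they are built.
\<close>

lemma wall:
  shows "0 \<le> k \<Longrightarrow> k \<le> n \<Longrightarrow> (k, - 1, True) \<in> moves \<tau> (nat (2 * k + 1))"
    and "0 \<le> k \<Longrightarrow> k < m \<Longrightarrow> (- k - 1, k, False) \<in> moves \<tau> (nat (2 * k + 2))"
    and "0 \<le> j \<Longrightarrow> j < 8 * int \<tau> \<Longrightarrow> (n + 1, j, False) \<in> moves \<tau> (nat (2 * (n + j) + 2))"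
    and "m \<le> j \<Longrightarrow> j < n + 8 * int \<tau> \<Longrightarrow> (- m - 1, j, True) \<in> moves \<tau> (nat (2 * j + 1))"
    and "n + 8 * int \<tau> \<le> j \<Longrightarrow> j < 9 * int \<tau> \<Longrightarrow> (- m - 1, j, True) \<in> moves \<tau> (nat (n + 8 * int \<tau> + 1 + j))"
    and "- m \<le> i \<Longrightarrow> i \<le> int \<tau> \<Longrightarrow> (i, 9 * int \<tau>, False) \<in> moves \<tau> (nat (18 * int \<tau> + i))"
    and "int \<tau> < i \<Longrightarrow> i < 4 * int \<tau> \<Longrightarrow> (i, 10 * int \<tau> - i, True) \<in> moves \<tau> (nat (18 * int \<tau> + i))"
    and "0 \<le> j \<Longrightarrow> j \<le> 6 * int \<tau> \<Longrightarrow> (4 * int \<tau>, j, False) \<in> moves \<tau> (nat (28 * int \<tau> - j))"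
    and "n + 1 < i \<Longrightarrow> i < 4 * int \<tau> \<Longrightarrow> (i, - 1, True) \<in> moves \<tau> (nat (32 * int \<tau> - i))"
proof -
  note c = corners[OF \<tau>]
  have *: "closing_move \<tau> s \<in> moves \<tau> (nat s)" if "int \<tau> \<le> s" for s
    using that by (auto simp: moves_def)
  have **: "wedge_move t \<in> moves \<tau> t" if "t \<le> \<tau>" for t
    using that by (auto simp: moves_def)
  show "0 \<le> k \<Longrightarrow> k \<le> n \<Longrightarrow> (k, - 1, True) \<in> moves \<tau> (nat (2 * k + 1))"
    using **[of "nat (2 * k + 1)"] c by (simp add: wedge_left_wall)
  show "0 \<le> k \<Longrightarrow> k < m \<Longrightarrow> (- k - 1, k, False) \<in> moves \<tau> (nat (2 * k + 2))"
    using **[of "nat (2 * k + 2)"] c by (simp add: wedge_right_wall)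
  show "0 \<le> j \<Longrightarrow> j < 8 * int \<tau> \<Longrightarrow> (n + 1, j, False) \<in> moves \<tau> (nat (2 * (n + j) + 2))"
    using *[of "2 * (n + j) + 2"] c \<tau> by (simp add: closing_move_def)
  show "m \<le> j \<Longrightarrow> j < n + 8 * int \<tau> \<Longrightarrow> (- m - 1, j, True) \<in> moves \<tau> (nat (2 * j + 1))"
    using *[of "2 * j + 1"] c \<tau> by (simp add: closing_move_def)
  show "n + 8 * int \<tau> \<le> j \<Longrightarrow> j < 9 * int \<tau> \<Longrightarrow> (- m - 1, j, True) \<in> moves \<tau> (nat (n + 8 * int \<tau> + 1 + j))"
    using *[of "n + 8 * int \<tau> + 1 + j"] c \<tau> by (simp add: closing_move_def)
  show "- m \<le> i \<Longrightarrow> i \<le> int \<tau> \<Longrightarrow> (i, 9 * int \<tau>, False) \<in> moves \<tau> (nat (18 * int \<tau> + i))"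
    using *[of "18 * int \<tau> + i"] c \<tau> by (simp add: closing_move_def)
  show "int \<tau> < i \<Longrightarrow> i < 4 * int \<tau> \<Longrightarrow> (i, 10 * int \<tau> - i, True) \<in> moves \<tau> (nat (18 * int \<tau> + i))"
    using *[of "18 * int \<tau> + i"] c \<tau> by (simp add: closing_move_def)
  show "0 \<le> j \<Longrightarrow> j \<le> 6 * int \<tau> \<Longrightarrow> (4 * int \<tau>, j, False) \<in> moves \<tau> (nat (28 * int \<tau> - j))"
    using *[of "28 * int \<tau> - j"] c \<tau> by (simp add: closing_move_def)
  show "n + 1 < i \<Longrightarrow> i < 4 * int \<tau> \<Longrightarrow> (i, - 1, True) \<in> moves \<tau> (nat (32 * int \<tau> - i))"
    using *[of "32 * int \<tau> - i"] c \<tau> by (simp add: closing_move_def)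
qed

text \<open>
  At each wall vertex next to the region it remains to compare the turn in which it is protected with
  the bound for its neighbour inside. In the sides of the spiral, the turn grows by 1 from vertex to
  vertex, while the bound is first constant and then, except on the last side, grows by 2; the critical vertices are those
  where two forms of the maximum agree, and the end of the last side. There the choice of the
  multiples of \<open>\<tau>\<close> enters.
\<close>

lemma region_step_from_False:
  assumes u: "(i, j, False) \<in> region \<tau>" and kl: "(k, l) \<in> {(i, j), (i - 1, j), (i, j - 1)}"
  shows "(k, l, True) \<in> region \<tau> \<and> arrival \<tau> (k, l, True) \<le> arrival \<tau> (i, j, False) + 1 \<or>
    (\<exists>s\<ge>1. s \<le> arrival \<tau> (i, j, False) + 1 \<and> (k, l, True) \<in> moves \<tau> (nat s))"
    (is "?in \<or> (\<exists>s\<ge>1. ?P s)")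
proof -
  note c = corners[OF \<tau>]
  have kl': "k = i \<and> l = j \<or> k = i - 1 \<and> l = j \<or> k = i \<and> l = j - 1" using kl by auto
  have u: "- m \<le> i" "i < 4 * int \<tau>" "0 \<le> j" "j < 9 * int \<tau>" "0 \<le> i + j" "i + j \<le> 10 * int \<tau>"
      "i = n + 1 \<longrightarrow> 8 * int \<tau> \<le> j"
    using u by (auto simp: region_def)
  \<comment> \<open>(a) left wall of the wedge, (b) last side, (d), (e) right wall of the strip, (f) the side
    \<open>i + j = 10 * \<tau>\<close>, (g) an edge inside the region\<close>
  consider (a) "j = 0" "i \<le> n" "k = i" "l = - 1" | (b) "j = 0" "n + 1 < i" "k = i" "l = - 1"
    | (d) "i = - m" "j < n + 8 * int \<tau>" "k = - m - 1" "l = j" | (e) "i = - m" "n + 8 * int \<tau> \<le> j" "k = - m - 1" "l = j"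
    | (f) "i + j = 10 * int \<tau>" "k = i" "l = j" 
    | (g) "j = 0 \<longrightarrow> l = j" "i = - m \<longrightarrow> k = i" "i + j < 10 * int \<tau> \<or> \<not> (k = i \<and> l = j)"
    using kl' u c \<tau> by smt
  then show ?thesis
  proof cases
    case a
    then have "?P (2 * i + 1)" using wall(1)[of i] u by (simp add: arrival_def)
    then show ?thesis using a u by (intro disjI2 exI[of _ "2 * i + 1"]) auto
  next
    case b
    then have "?P (32 * int \<tau> - i)" using wall(9)[of i] u c by (simp add: arrival_def)
    then show ?thesis using u by (intro disjI2 exI[of _ "32 * int \<tau> - i"]) auto
  next
    case d
    then have "?P (2 * j + 1)" using wall(4)[of j] u c by (simp add: arrival_def)
    then show ?thesis using u by (intro disjI2 exI[of _ "2 * j + 1"]) auto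
  next
    case e
    then have "?P (n + 8 * int \<tau> + 1 + j)" using wall(5)[of j] u c by (simp add: arrival_def)
    then show ?thesis using u c by (intro disjI2 exI[of _ "n + 8 * int \<tau> + 1 + j"]) auto
  next
    case f
    then have "int \<tau> < i" "n < i" "j = 10 * int \<tau> - i" using u c by linarith+
    then have "?P (18 * int \<tau> + i)"
      using wall(7)[of i] u(2,4) c unfolding \<open>j = 10 * int \<tau> - i\<close> f(2,3)
      by (simp add: arrival_def max_def)
    then show ?thesis using u c f by (intro disjI2 exI[of _ "18 * int \<tau> + i"]) auto
  next
    case g
    then have "- m \<le> k" "0 \<le> l" "k + l < 10 * int \<tau>" using kl' u by smt+
    then have "(k, l, True) \<in> region \<tau>" using kl' u by (auto simp: region_def)
    moreover have "arrival \<tau> (k, l, True) \<le> arrival \<tau> (i, j, False) + 1"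
      using kl' g u(5,7) c(4) unfolding arrival_def prod.case of_bool_eq max_def by smt
    ultimately show ?thesis by blast
  qed
qed

lemma region_step_from_True:
  assumes u: "(k, l, True) \<in> region \<tau>" and kl: "(k, l) \<in> {(i, j), (i - 1, j), (i, j - 1)}"
  shows "(i, j, False) \<in> region \<tau> \<and> arrival \<tau> (i, j, False) \<le> arrival \<tau> (k, l, True) + 1 \<or>
    (\<exists>s\<ge>1. s \<le> arrival \<tau> (k, l, True) + 1 \<and> (i, j, False) \<in> moves \<tau> (nat s))"
    (is "?in \<or> (\<exists>s\<ge>1. ?P s)")
proof -
  note c = corners[OF \<tau>]
  have kl': "k = i \<and> l = j \<or> k = i - 1 \<and> l = j \<or> k = i \<and> l = j - 1" using kl by auto
  have u: "- m \<le> k" "k < 4 * int \<tau>" "0 \<le> l" "l < 9 * int \<tau>" "- 1 \<le> k + l" "k + l < 10 * int \<tau>"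
    using u by (auto simp: region_def)
  \<comment> \<open>(a) right wall of the wedge, (b) slit, (d) the side \<open>j = 9 * \<tau>\<close>, (e) the side
    \<open>i = 4 * \<tau>\<close>, (f) an edge inside the region\<close>
  consider (a) "i + j = - 1" "k = i" "l = j" 
    | (b) "0 \<le> i + j" "i = n + 1" "j < 8 * int \<tau>"
    | (d) "j = 9 * int \<tau>" "k = i" "l = j - 1"
    | (e) "i = 4 * int \<tau>" "j < 9 * int \<tau>" "k = i - 1" "l = j"
    | (f) "0 \<le> i + j" "i = n + 1 \<longrightarrow> 8 * int \<tau> \<le> j" "j < 9 * int \<tau>" "i < 4 * int \<tau>"
    using kl' u c \<tau> by smt
  then show ?thesis
  proof cases
    case a
    then have i: "i = - j - 1" and k: "k = - j - 1" by auto
    have "?P (2 * j + 2)" using wall(2)[of j] u(1,3) c a unfolding i k by (simp add: arrival_def)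
    then show ?thesis using a u by (intro disjI2 exI[of _ "2 * j + 2"]) auto
  next
    case b
    have "0 \<le> j" using u kl by auto
    then have "?P (2 * (n + j) + 2)" using wall(3)[of j] b u c kl by (auto simp: arrival_def)
    then show ?thesis using \<open>0 \<le> j\<close> c by (intro disjI2 exI[of _ "2 * (n + j) + 2"]) auto
  next
    case d
    then have "i \<le> int \<tau>" using u by auto
    then have "?P (18 * int \<tau> + i)" using wall(6)[of i] d u c \<tau> by (simp add: arrival_def max_def)
    then show ?thesis using u c d by (intro disjI2 exI[of _ "18 * int \<tau> + i"]) auto
  next
    case e
    then have "j \<le> 6 * int \<tau>" using u by auto
    then have "?P (28 * int \<tau> - j)" using wall(8)[of j] e u c \<tau> by (simp add: arrival_def max_def)
    then show ?thesis using u \<open>j \<le> 6 * int \<tau>\<close> \<tau> by (intro disjI2 exI[of _ "28 * int \<tau> - j"]) auto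
  next
    case f
    then have "- m \<le> i" "0 \<le> j" "i + j \<le> 10 * int \<tau>" using kl' u by smt+
    then have "(i, j, False) \<in> region \<tau>" using f by (auto simp: region_def)
    moreover have "arrival \<tau> (i, j, False) \<le> arrival \<tau> (k, l, True) + 1"
      using kl' f u c(4) unfolding arrival_def prod.case of_bool_eq max_def by smt
    ultimately show ?thesis by blast
  qed
qed

end


lemma finite_region: "finite (region \<tau>)"
proof (rule finite_subset)
  show "region \<tau> \<subseteq> {- right_corner \<tau>..4 * int \<tau>} \<times> {0..9 * int \<tau>} \<times> UNIV"
    by (auto simp: region_def)
qed simp

lemma burning_subset_region:
  assumes "1 \<le> \<tau>"
  shows "burning hex_adj hex_origin (moves \<tau>) t \<subseteq> region \<tau>"
proof -
  note c = corners[OF assms]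
  have "burning hex_adj hex_origin (moves \<tau>) t \<subseteq> {u \<in> region \<tau>. arrival \<tau> u \<le> int t}"
  proof (rule burning_subset_certified)
    show "hex_origin \<in> region \<tau>" "arrival \<tau> hex_origin \<le> 0"
      using c assms by (simp_all add: region_def arrival_def)
  next
    fix u u' assume u: "u \<in> region \<tau>" "hex_adj u u'"
    have "u' \<in> region \<tau> \<and> arrival \<tau> u' \<le> arrival \<tau> u + 1 \<or>
        (\<exists>s\<ge>1. s \<le> arrival \<tau> u + 1 \<and> u' \<in> moves \<tau> (nat s))"
    proof (cases "(u, u')" rule: hex_adj.cases)
      case (1 i j k l)
      then show ?thesis using region_step_from_False[OF assms, of i j k l] u by simp
    next
      case (2 k l i j)
      then show ?thesis using region_step_from_True[OF assms, of k l i j] u by simp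
    qed (use u in auto)
    moreover have "\<exists>s'\<ge>1. int s' \<le> a \<and> u' \<in> moves \<tau> s'"
      if "1 \<le> s" "s \<le> a" "u' \<in> moves \<tau> (nat s)" for s a
      using that by (intro exI[of _ "nat s"]) auto
    ultimately show "u' \<in> region \<tau> \<and> arrival \<tau> u' \<le> arrival \<tau> u + 1 \<or>
        (\<exists>s\<ge>1. int s \<le> arrival \<tau> u + 1 \<and> u' \<in> moves \<tau> s)"
      by blast
  qed
  then show ?thesis by blast
qed

lemma moves_Int_region:
  assumes "1 \<le> \<tau>"
  shows "moves \<tau> t \<inter> region \<tau> = {}"
proof -
  note c = corners[OF assms]
  have "wedge_move t \<notin> region \<tau>"
    by (auto simp: wedge_move_def region_def)
  moreover have "closing_move \<tau> s \<notin> region \<tau>" for s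
    using c assms by (auto simp: closing_move_def region_def)
  ultimately show ?thesis by (auto simp: moves_def)
qed

lemma moves_contain_fire:
  assumes "1 \<le> t\<^sub>1"
  shows "legal_play hex_adj hex_origin (extra_at t\<^sub>1 t\<^sub>2) (moves t\<^sub>1)"
    and "contains_fire hex_adj hex_origin (moves t\<^sub>1)"
proof -
  have "card (moves t\<^sub>1 t) \<ge> 1" "card (moves t\<^sub>1 t) \<le> 1 + extra_at t\<^sub>1 t\<^sub>2 t" for t
    by (auto simp: moves_def extra_at_def card_insert_if)
  then show "legal_play hex_adj hex_origin (extra_at t\<^sub>1 t\<^sub>2) (moves t\<^sub>1)"
    using burning_subset_region[OF assms] moves_Int_region[OF assms]
    unfolding legal_play_def by blast
  show "contains_fire hex_adj hex_origin (moves t\<^sub>1)"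
    using finite_region burning_subset_region[OF assms] by (rule contains_fire_if_finite)
qed

text \<open>
  The number of leading zeros tells \<open>\<tau>\<close>. If no extra protection has appeared up to turn \<open>t\<close>, this
  yields \<open>\<tau> = t + 1\<close>, for which the move in turn \<open>t\<close> is that of the wedge.
\<close>

definition strategy :: "hex_vertex online_strategy" where
  "strategy es = moves (Suc (length (takeWhile (\<lambda>e. e = 0) es))) (length es)"

lemma play_of_strategy:
  assumes "1 \<le> t\<^sub>1" "t\<^sub>1 \<le> t\<^sub>2"
  shows "play_of strategy (extra_at t\<^sub>1 t\<^sub>2) = moves t\<^sub>1"
proof
  fix t
  let ?es = "map (extra_at t\<^sub>1 t\<^sub>2) [1..<Suc t]"
  show "play_of strategy (extra_at t\<^sub>1 t\<^sub>2) t = moves t\<^sub>1 t"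
  proof (cases "t < t\<^sub>1")
    case True
    then have "\<forall>e\<in>set ?es. e = 0" using assms by (auto simp: extra_at_def)
    then have "takeWhile (\<lambda>e. e = 0) ?es = ?es" by (simp only: takeWhile_eq_all_conv)
    then have "play_of strategy (extra_at t\<^sub>1 t\<^sub>2) t = moves (Suc t) t"
      by (simp only: play_of_def strategy_def length_map length_upt) simp
    then show ?thesis using True by (simp add: moves_def)
  next
    case False
    have "[1..<Suc t] = [1..<t\<^sub>1] @ t\<^sub>1 # [Suc t\<^sub>1..<Suc t]"
      using False assms upt_add_eq_append[of 1 t\<^sub>1 "Suc t - t\<^sub>1"] upt_conv_Cons[of t\<^sub>1 "Suc t"]
      by (simp del: upt_Suc)
    moreover have "takeWhile (\<lambda>e. e = 0) (map (extra_at t\<^sub>1 t\<^sub>2) [1..<t\<^sub>1] @ extra_at t\<^sub>1 t\<^sub>2 t\<^sub>1 # es)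
        = map (extra_at t\<^sub>1 t\<^sub>2) [1..<t\<^sub>1]" for es
      using assms by (subst takeWhile_append2) (auto simp: extra_at_def)
    ultimately have "length (takeWhile (\<lambda>e. e = 0) ?es) = t\<^sub>1 - 1"
      by (simp del: upt_Suc)
    then show ?thesis using assms(1) by (simp add: play_of_def strategy_def del: upt_Suc)
  qed
qed

section \<open>All starting vertices\<close>

theorem theorem3:
  "(\<forall>v. surviving_rate hex_adj v \<ge> ereal (2 / 3)) \<and>
   (\<forall>v t\<^sub>1 t\<^sub>2. 1 \<le> t\<^sub>1 \<longrightarrow> t\<^sub>1 \<le> t\<^sub>2 \<longrightarrow>
      (\<exists>P. legal_play hex_adj v (extra_at t\<^sub>1 t\<^sub>2) P \<and> contains_fire hex_adj v P)) \<and>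
   (\<forall>v. \<exists>\<sigma>. \<forall>t\<^sub>1 t\<^sub>2. 1 \<le> t\<^sub>1 \<longrightarrow> t\<^sub>1 \<le> t\<^sub>2 \<longrightarrow>
      legal_play hex_adj v (extra_at t\<^sub>1 t\<^sub>2) (play_of \<sigma> (extra_at t\<^sub>1 t\<^sub>2)) \<and>
      contains_fire hex_adj v (play_of \<sigma> (extra_at t\<^sub>1 t\<^sub>2)))"
proof (intro conjI allI)
  fix v
  let ?P = "\<lambda>t. hex_move v ` {wedge_move t}"
  have "legal_play hex_adj v (\<lambda>_. 0) ?P"
    using automorphism_legal_play[OF automorphism_hex_move legal_play_wedge, of v]
    by (simp add: hex_move_origin)
  moreover have "ereal (2 / 3) \<le> surviving_rate_of hex_adj v ?P"
    using surviving_rate_of_wedge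
      automorphism_surviving_rate_of[OF automorphism_hex_move, of v hex_origin "\<lambda>t. {wedge_move t}"]
    by (simp add: hex_move_origin)
  ultimately show "surviving_rate hex_adj v \<ge> ereal (2 / 3)"
    unfolding surviving_rate_def by (intro SUP_upper2[of ?P]) simp_all
next
  have moved: "legal_play hex_adj v (extra_at t\<^sub>1 t\<^sub>2) (\<lambda>t. hex_move v ` moves t\<^sub>1 t) \<and>
      contains_fire hex_adj v (\<lambda>t. hex_move v ` moves t\<^sub>1 t)" if "1 \<le> t\<^sub>1" for v t\<^sub>1 t\<^sub>2
    using automorphism_legal_play[OF automorphism_hex_move moves_contain_fire(1)[OF that], of v t\<^sub>2]
      automorphism_contains_fire[OF automorphism_hex_move moves_contain_fire(2)[OF that], of v]
    by (simp add: hex_move_origin)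
  then show "1 \<le> t\<^sub>1 \<longrightarrow> t\<^sub>1 \<le> t\<^sub>2 \<longrightarrow>
      (\<exists>P. legal_play hex_adj v (extra_at t\<^sub>1 t\<^sub>2) P \<and> contains_fire hex_adj v P)" for v t\<^sub>1 t\<^sub>2
    by blast
  have "play_of (\<lambda>es. hex_move v ` strategy es) (extra_at t\<^sub>1 t\<^sub>2) = (\<lambda>t. hex_move v ` moves t\<^sub>1 t)"
    if "1 \<le> t\<^sub>1" "t\<^sub>1 \<le> t\<^sub>2" for v t\<^sub>1 t\<^sub>2
    using fun_cong[OF play_of_strategy[OF that]] by (simp add: play_of_def fun_eq_iff del: upt_Suc)
  then show "\<exists>\<sigma>. \<forall>t\<^sub>1 t\<^sub>2. 1 \<le> t\<^sub>1 \<longrightarrow> t\<^sub>1 \<le> t\<^sub>2 \<longrightarrow>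
      legal_play hex_adj v (extra_at t\<^sub>1 t\<^sub>2) (play_of \<sigma> (extra_at t\<^sub>1 t\<^sub>2)) \<and>
      contains_fire hex_adj v (play_of \<sigma> (extra_at t\<^sub>1 t\<^sub>2))" for v
    using moved by (intro exI[of _ "\<lambda>es. hex_move v ` strategy es"]) simp
qed

end
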